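(* Let $k\ge 1$, $g\ge 1$, $n\ge 1$, $r\ge 1$ be integers, let $p\in(0,1)$ and $q=1-p$. Let $p_{n,r}$ denote the probability that there are exactly $r$ success runs (of order $k$ with gap $g$) in $n$ independent Bernoulli trials with success probability $p$. Then $$ \begin{aligned} p_{n,r} &= \sum_{m=r}^{\left\lfloor \frac{n+1-(r-1)(g-1)}{k+1}\right\rfloor} (-1)^{m-r} q^{m-1}p^{mk}\binom{m-1}{r-1}\left[\binom{n-mk+1-(r-1)(g-1)}{m}-p\binom{n-mk-(r-1)(g-1)}{m}\right]\\ &\quad-\sum_{m=r+1}^{\left\lfloor \frac{n+1-r(g-1)}{k+1}\right\rfloor} (-1)^{m-r-1} q^{m-1}p^{mk}\binom{m-1}{r}\left[\binom{n-mk+1-r(g-1)}{m}-p\binom{n-mk-r(g-1)}{m}\right], \end{aligned} $$ where a sum whose upper limit is smaller than its lower limit is zero.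
   Context: Consider a sequence of $n$ independent trials, each $S$ (success) with probability $p$ or $F$ (failure) with probability $q=1-p$. The success runs (of order $k$ with gap $g$) are defined inductively. The first success run (if it exists) is the first run of at least $k$ consecutive successes, taken maximal (it cannot be extended to a longer run). A success run terminates at trial $m$ if trial $m$ is its last success, i.e. either $m=n$ or trial $m+1$ is a failure. If the $j$-th success run terminates at trial $m$, then the $(j+1)$-th success run (if it exists) is the first run of at least $k$ consecutive successes which begins later than trial $m+g$, taken maximal among runs beginning later than trial $m+g$ (trials $m+1,\dots,m+g$ form the gap: an $F$ followed by $g-1$ arbitrary outcomes). *)

theory Defs
  imports "HOL-Probability.Probability"
begin

(* Outcomes are functions w :: nat \<Rightarrow> bool; trial i, for i in {1..n}, is a success iff w i. *)

(* The trials a, ..., b form a run of at least k consecutive successes. *)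
definition long_run :: "nat \<Rightarrow> nat \<Rightarrow> (nat \<Rightarrow> bool) \<Rightarrow> nat \<Rightarrow> nat \<Rightarrow> bool" where
  "long_run k n w a b \<longleftrightarrow>
     1 \<le> a \<and> a \<le> b \<and> b \<le> n \<and> a + k \<le> b + 1 \<and> (\<forall>i\<in>{a..b}. w i)"

(* Maximality is only among the runs beginning later than trial s: if s > 0, trial s itself may be
   a success. *)
definition maximal_run_after ::
  "nat \<Rightarrow> nat \<Rightarrow> (nat \<Rightarrow> bool) \<Rightarrow> nat \<Rightarrow> nat \<Rightarrow> nat \<Rightarrow> bool" where
  "maximal_run_after k n w s a b \<longleftrightarrow>
     long_run k n w a b \<and> s < a \<and>
     (\<forall>a' b'. long_run k n w a' b' \<and> s < a' \<and> a' \<le> a \<and> b \<le> b' \<longrightarrow> a' = a \<and> b' = b)"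

definition first_run_after ::
  "nat \<Rightarrow> nat \<Rightarrow> (nat \<Rightarrow> bool) \<Rightarrow> nat \<Rightarrow> nat \<Rightarrow> nat \<Rightarrow> bool" where
  "first_run_after k n w s a b \<longleftrightarrow>
     maximal_run_after k n w s a b \<and> (\<forall>a' b'. maximal_run_after k n w s a' b' \<longrightarrow> a \<le> a')"

(* success_run k g n w j a b: the j-th success run exists, begins at trial a and terminates at
   trial b. For the first one, "beginning later than trial 0" is no restriction. *)
inductive success_run ::
  "nat \<Rightarrow> nat \<Rightarrow> nat \<Rightarrow> (nat \<Rightarrow> bool) \<Rightarrow> nat \<Rightarrow> nat \<Rightarrow> nat \<Rightarrow> bool"
  for k g n :: nat and w :: "nat \<Rightarrow> bool" where
  first: "first_run_after k n w 0 a b \<Longrightarrow> success_run k g n w 1 a b"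
| next_run: "success_run k g n w j a b \<Longrightarrow> first_run_after k n w (b + g) a' b'
    \<Longrightarrow> success_run k g n w (Suc j) a' b'"

definition num_success_runs :: "nat \<Rightarrow> nat \<Rightarrow> nat \<Rightarrow> (nat \<Rightarrow> bool) \<Rightarrow> nat" where
  "num_success_runs k g n w = card {(a, b). \<exists>j. success_run k g n w j a b}"

definition bernoulli_trials :: "nat \<Rightarrow> real \<Rightarrow> (nat \<Rightarrow> bool) pmf" where
  "bernoulli_trials n p = Pi_pmf {1..n} False (\<lambda>_. bernoulli_pmf p)"

definition success_runs_prob :: "nat \<Rightarrow> nat \<Rightarrow> real \<Rightarrow> nat \<Rightarrow> nat \<Rightarrow> real" where
  "success_runs_prob k g p n r =
     measure_pmf.prob (bernoulli_trials n p) {w. num_success_runs k g n w = r}"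

end

(* Let N_s be the number of success runs found when the scan restarts after trial s. The numbers N_s
   and N_(s+1) can differ only if the trials after s begin with exactly k successes followed by a
   failure (or by the end of the trials); in that case N_s = 1 + N_(s+k+g) and
   N_(s+1) = N_(s+k+1). By independence
     P(N_s >= r) = P(N_(s+1) >= r) + p^k q (P(N_(s+k+g) >= r-1) - P(N_(s+k+1) >= r)).
   Applying Pascal's rule to both binomial coefficients shows that the first sum of the theorem,
   with n replaced by n - s, obeys the same recursion, so it equals P(N_s >= r). The second sum is
   the first one with r + 1 in place of r. *)

theory Submission
  imports Defs
begin

section \<open>Scanning from an arbitrary starting trial\<close>

text \<open>\<open>success_run\<close> grows at its last run; here the first run is peeled off
  instead, so that the count obeys a recursion in the starting trial \<open>s\<close>.\<close>

inductive success_run_from ::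
  "nat \<Rightarrow> nat \<Rightarrow> nat \<Rightarrow> (nat \<Rightarrow> bool) \<Rightarrow> nat \<Rightarrow> nat \<Rightarrow> nat \<Rightarrow> bool"
  for k g n :: nat and w :: "nat \<Rightarrow> bool" where
  start: "first_run_after k n w s a b \<Longrightarrow> success_run_from k g n w s a b"
| later: "first_run_after k n w s a b \<Longrightarrow> success_run_from k g n w (b + g) a' b'
    \<Longrightarrow> success_run_from k g n w s a' b'"

definition runs_count_from :: "nat \<Rightarrow> nat \<Rightarrow> nat \<Rightarrow> (nat \<Rightarrow> bool) \<Rightarrow> nat \<Rightarrow> nat" where
  "runs_count_from k g n w s = card {(a, b). success_run_from k g n w s a b}"

lemma success_run_from_append:
  assumes "success_run_from k g n w s a b" "first_run_after k n w (b + g) a' b'"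
  shows "success_run_from k g n w s a' b'"
  using assms by induction (meson success_run_from.intros)+

text \<open>The starting trial moves during the induction, so \<open>s\<close> ranges over all
  trials at which the original scan starts or restarts.\<close>

lemma success_run_from_imp_success_run:
  assumes "success_run_from k g n w s a' b'"
    and "s = 0 \<or> (\<exists>j a b. success_run k g n w j a b \<and> s = b + g)"
  shows "\<exists>j. success_run k g n w j a' b'"
  using assms
proof induction
  case (start s a b)
  then show ?case
    by (metis success_run.first success_run.next_run)
next
  case (later s a b a' b')
  then have "\<exists>j. success_run k g n w j a b"
    by (metis success_run.first success_run.next_run)
  then show ?case using later.IH by blast
qed

lemma success_run_imp_success_run_from:
  "success_run k g n w j a b \<Longrightarrow> success_run_from k g n w 0 a b"
  by (induction rule: success_run.induct)
    (simp_all add: success_run_from.start success_run_from_append)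

lemma num_success_runs_eq: "num_success_runs k g n w = runs_count_from k g n w 0"
proof -
  have "(\<exists>j. success_run k g n w j a b) = success_run_from k g n w 0 a b" for a b
    using success_run_from_imp_success_run success_run_imp_success_run_from by blast
  then show ?thesis
    unfolding num_success_runs_def runs_count_from_def by simp
qed

lemma first_run_after_long_run:
  "first_run_after k n w s a b \<Longrightarrow> long_run k n w a b \<and> s < a"
  by (simp add: first_run_after_def maximal_run_after_def)

lemma first_run_after_unique:
  assumes "first_run_after k n w s a b" "first_run_after k n w s a' b'"
  shows "a = a' \<and> b = b'"
proof -
  have a: "a = a'" using assms unfolding first_run_after_def by (meson le_antisym)
  have "b \<le> b' \<or> b' \<le> b" by linarith
  then show ?thesis
    using assms a unfolding first_run_after_def maximal_run_after_def by blast
qed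

lemma success_run_from_bounds:
  assumes "success_run_from k g n w s a b"
  shows "s < a \<and> a \<le> b \<and> b \<le> n"
  using assms
proof induction
  case (start s a b)
  then show ?case by (auto dest!: first_run_after_long_run simp: long_run_def)
next
  case (later s a b a' b')
  then show ?case by (auto dest!: first_run_after_long_run simp: long_run_def)
qed

text \<open>All later runs begin after \<open>b + g\<close>, hence differ from
  \<open>(a, b)\<close>, and there are finitely many of them, so inserting \<open>(a, b)\<close>
  raises the cardinality by one.\<close>

lemma runs_count_from_Suc:
  assumes "first_run_after k n w s a b"
  shows "runs_count_from k g n w s = Suc (runs_count_from k g n w (b + g))"
proof -
  let ?S = "\<lambda>s. {(a, b). success_run_from k g n w s a b}"
  have "success_run_from k g n w s a' b' \<longleftrightarrow>
      (a', b') = (a, b) \<or> success_run_from k g n w (b + g) a' b'" for a' b'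
    using assms first_run_after_unique[OF assms] unfolding success_run_from.simps[of k g n w s]
    by blast
  then have eq: "?S s = insert (a, b) (?S (b + g))" by auto
  have "?S (b + g) \<subseteq> {..n} \<times> {..n}"
    using success_run_from_bounds by fastforce
  then have "finite (?S (b + g))"
    by (rule finite_subset) auto
  moreover have "(a, b) \<notin> ?S (b + g)"
    using success_run_from_bounds first_run_after_long_run[OF assms]
    by (fastforce simp: long_run_def)
  ultimately show ?thesis
    unfolding runs_count_from_def eq by simp
qed

lemma runs_count_from_eq_0:
  assumes "s + k > n"
  shows "runs_count_from k g n w s = 0"
proof -
  have "\<not> first_run_after k n w s a b" for a b
    using assms first_run_after_long_run[of k n w s a b] by (auto simp: long_run_def)
  then have "\<not> success_run_from k g n w s a b" for a b
    by (simp add: success_run_from.simps[of k g n w s])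
  then show ?thesis by (simp add: runs_count_from_def)
qed

section \<open>Moving the starting trial\<close>

text \<open>Nothing after \<open>s\<close> can begin before \<open>s + 1\<close>, so only extension
  to the right has to be excluded.\<close>

lemma first_run_after_Suc_start:
  assumes "k \<ge> 1" "\<forall>i\<in>{s+1..b}. w i" "s + k \<le> b" "b \<le> n" "b = n \<or> \<not> w (b + 1)"
  shows "first_run_after k n w s (s + 1) b"
proof -
  have "b' = b" if "long_run k n w (s+1) b'" "b \<le> b'" for b'
  proof (rule ccontr)
    assume "b' \<noteq> b"
    then show False using that assms(3,5) by (auto simp: long_run_def)
  qed
  then show ?thesis using assms
    by (auto simp: first_run_after_def maximal_run_after_def long_run_def)
qed

text \<open>Comparison with one-trial extensions suffices: any longer run contains trial
  \<open>a - 1\<close> or trial \<open>b + 1\<close>. On the left, \<open>s\<close> acts as a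
  wall.\<close>

lemma maximal_run_after_iff:
  assumes "k \<ge> 1"
  shows "maximal_run_after k n w s a b \<longleftrightarrow>
    long_run k n w a b \<and> s < a \<and> (a = s + 1 \<or> \<not> w (a - 1)) \<and> (b = n \<or> \<not> w (b + 1))"
proof (intro iffI conjI)
  assume m: "maximal_run_after k n w s a b"
  show "long_run k n w a b" "s < a" using m by (auto simp: maximal_run_after_def)
  show "a = s + 1 \<or> \<not> w (a - 1)"
  proof (rule ccontr)
    assume neg: "\<not> (a = s + 1 \<or> \<not> w (a - 1))"
    have "w i" if "i \<in> {a-1..b}" for i
      using that neg m by (cases "i = a - 1") (auto simp: maximal_run_after_def long_run_def)
    then have "long_run k n w (a - 1) b \<and> s < a - 1"
      using neg m by (auto simp: maximal_run_after_def long_run_def)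
    then have "a - 1 = a" using m unfolding maximal_run_after_def by (meson diff_le_self order_refl)
    then show False using \<open>s < a\<close> by simp
  qed
  show "b = n \<or> \<not> w (b + 1)"
  proof (rule ccontr)
    assume neg: "\<not> (b = n \<or> \<not> w (b + 1))"
    have "w i" if "i \<in> {a..b+1}" for i
      using that neg m by (cases "i = b + 1") (auto simp: maximal_run_after_def long_run_def)
    then have "long_run k n w a (b + 1)"
      using neg m by (auto simp: maximal_run_after_def long_run_def)
    then have "b + 1 = b" using m unfolding maximal_run_after_def by (meson le_add1 order_refl)
    then show False by simp
  qed
next
  assume R: "long_run k n w a b \<and> s < a \<and> (a = s + 1 \<or> \<not> w (a - 1)) \<and> (b = n \<or> \<not> w (b + 1))"
  have "a' = a \<and> b' = b" if "long_run k n w a' b'" "s < a'" "a' \<le> a" "b \<le> b'" for a' b'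
  proof
    show "a' = a"
    proof (rule ccontr)
      assume "a' \<noteq> a"
      then have "a - 1 \<in> {a'..b'}" "a \<noteq> s + 1" using that R by (auto simp: long_run_def)
      then show False using that R by (auto simp: long_run_def)
    qed
    show "b' = b"
    proof (rule ccontr)
      assume "b' \<noteq> b"
      then have "b + 1 \<in> {a'..b'}" "b \<noteq> n" using that R by (auto simp: long_run_def)
      then show False using that R by (auto simp: long_run_def)
    qed
  qed
  then show "maximal_run_after k n w s a b" using R unfolding maximal_run_after_def by blast
qed

lemma first_run_after_cong:
  assumes "\<And>a b. maximal_run_after k n w s a b = maximal_run_after k n w' s' a b"
  shows "first_run_after k n w s = first_run_after k n w' s'"
  using assms by (intro ext) (simp add: first_run_after_def)

lemma runs_count_from_Suc_start:
  assumes "k \<ge> 1" "\<not> (\<forall>i\<in>{s+1..s+k}. w i)"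
  shows "runs_count_from k g n w s = runs_count_from k g n w (s + 1)"
proof -
  have "maximal_run_after k n w s a b = maximal_run_after k n w (s + 1) a b" for a b
  proof (cases "long_run k n w a b")
    case True
    then have all: "w i" if "a \<le> i" "i < a + k" for i
      using that by (auto simp: long_run_def)
    have "a \<noteq> s + 1" using all assms(2) by auto
    \<comment> \<open>The only run whose status could change begins at \<open>s + 2\<close> right
      after a success; trial \<open>s + 1\<close> would then complete the \<open>k\<close> successes
      excluded by assumption.\<close>
    moreover have "\<not> w (a - 1)" if "a = s + 2"
    proof
      assume w: "w (a - 1)"
      have "w i" if "i \<in> {s+1..s+k}" for i
      proof (cases "i = s + 1")
        case True then show ?thesis using w \<open>a = s + 2\<close> by simp
      next
        case False then show ?thesis using all[of i] that \<open>a = s + 2\<close> by simp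
      qed
      then show False using assms(2) by blast
    qed
    ultimately show ?thesis using assms(1) by (auto simp: maximal_run_after_iff)
  next
    case False
    then show ?thesis by (simp add: maximal_run_after_def)
  qed
  then have eq: "first_run_after k n w s = first_run_after k n w (s + 1)"
    by (rule first_run_after_cong)
  have "success_run_from k g n w s a b = success_run_from k g n w (s + 1) a b" for a b
    unfolding success_run_from.simps[of k g n w s] success_run_from.simps[of k g n w "s + 1"]
    by (simp add: eq)
  then show ?thesis by (simp add: runs_count_from_def)
qed

text \<open>The start advances one trial at a time; each window of \<open>k\<close> trials passed on
  the way contains the failure \<open>t\<close>.\<close>

lemma runs_count_from_skip:
  assumes "k \<ge> 1" "\<not> w t" "s \<le> t" "t \<le> s + k"
  shows "runs_count_from k g n w s = runs_count_from k g n w t"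
  using assms(3,4)
proof (induction s rule: inc_induct)
  case (step m)
  then have "runs_count_from k g n w m = runs_count_from k g n w (m + 1)"
    using assms(1,2) by (intro runs_count_from_Suc_start) auto
  then show ?case using step by simp
qed simp

text \<open>Dropping the first success of a block longer than \<open>k\<close> leaves a run with the
  same last trial, so both scans restart at the same place.\<close>

lemma runs_count_from_Suc_start_long:
  assumes "k \<ge> 1" "\<forall>i\<in>{s+1..s+k+1}. w i" "s + k + 1 \<le> n"
  shows "runs_count_from k g n w s = runs_count_from k g n w (s + 1)"
proof -
  \<comment> \<open>The last trial of the block of successes that begins at
    \<open>s + 1\<close>.\<close>
  define b where "b = (GREATEST b. b \<le> n \<and> (\<forall>i\<in>{s+1..b}. w i))"
  have b: "b \<le> n \<and> (\<forall>i\<in>{s+1..b}. w i)"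
    unfolding b_def by (rule GreatestI_nat[where b = n and k = "s + k + 1"]) (use assms in auto)
  have max: "c \<le> b" if "c \<le> n \<and> (\<forall>i\<in>{s+1..c}. w i)" for c
    unfolding b_def by (rule Greatest_le_nat[where b = n]) (use that in auto)
  have "s + k + 1 \<le> b" using max assms by simp
  moreover have "b = n \<or> \<not> w (b + 1)"
  proof (rule ccontr)
    assume "\<not> (b = n \<or> \<not> w (b + 1))"
    then have "b + 1 \<le> n \<and> (\<forall>i\<in>{s+1..b+1}. w i)"
      using b by (auto simp: le_Suc_eq)
    then show False using max by fastforce
  qed
  ultimately have "first_run_after k n w s (s + 1) b" "first_run_after k n w (s + 1) (s + 1 + 1) b"
    using b assms(1) by (intro first_run_after_Suc_start; simp)+
  then show ?thesis by (simp add: runs_count_from_Suc)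
qed

section \<open>Locality of the scan\<close>

lemma first_run_after_local:
  assumes "\<forall>i>s. w i = w' i"
  shows "first_run_after k n w s = first_run_after k n w' s"
proof (rule first_run_after_cong)
  have "long_run k n w a b = long_run k n w' a b" if "s < a" for a b
    using assms that by (auto simp: long_run_def)
  then show "maximal_run_after k n w s a b = maximal_run_after k n w' s a b" for a b
    unfolding maximal_run_after_def by blast
qed

lemma success_run_from_local:
  assumes "success_run_from k g n w s a b" "\<forall>i>s. w i = w' i"
  shows "success_run_from k g n w' s a b"
  using assms
proof induction
  case (start s a b)
  then show ?case by (metis first_run_after_local success_run_from.start)
next
  case (later s a b a' b')
  then have f: "first_run_after k n w' s a b" by (metis first_run_after_local)
  have "s < b" using first_run_after_long_run[OF f] by (auto simp: long_run_def)
  then show ?case using later.IH later.prems success_run_from.later[OF f] by simp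
qed

text \<open>This is the source of independence: the count from \<open>s\<close> ignores the trials
  up to \<open>s\<close>.\<close>

lemma runs_count_from_local:
  assumes "\<forall>i>s. w i = w' i"
  shows "runs_count_from k g n w s = runs_count_from k g n w' s"
proof -
  have "success_run_from k g n w s a b = success_run_from k g n w' s a b" for a b
    using assms success_run_from_local[of k g n _ s a b] by metis
  then show ?thesis by (simp add: runs_count_from_def)
qed

section \<open>Independence of the trials\<close>

text \<open>The product rule is applied to countable sets, obtained by cutting \<open>A\<close> and
  \<open>B\<close> down to the supports.\<close>

lemma prob_pair_pmf_Times:
  "measure_pmf.prob (pair_pmf M N) (A \<times> B) = measure_pmf.prob M A * measure_pmf.prob N B"
proof -
  have "measure_pmf.prob (pair_pmf M N) (A \<times> B) =
      measure_pmf.prob (pair_pmf M N) ((A \<inter> set_pmf M) \<times> (B \<inter> set_pmf N))"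
    by (subst measure_Int_set_pmf[symmetric]) (simp add: Times_Int_Times)
  also have "\<dots> = measure_pmf.prob M (A \<inter> set_pmf M) * measure_pmf.prob N (B \<inter> set_pmf N)"
    by (intro measure_pmf_prob_product countable_Int2) simp_all
  finally show ?thesis by (simp add: measure_Int_set_pmf)
qed

text \<open>The last assumption says that \<open>P\<close> ignores trial \<open>i\<close>; splitting
  off that coordinate turns the event into a rectangle.\<close>

lemma prob_bernoulli_trials_conj:
  assumes "0 \<le> p" "p \<le> 1" "i \<in> {1..n}" "\<And>w x. P (w(i := x)) = P w"
  shows "measure_pmf.prob (bernoulli_trials n p) {w. w i = b \<and> P w} =
    (if b then p else 1 - p) * measure_pmf.prob (bernoulli_trials n p) {w. P w}"
proof -
  let ?A = "{1..n} - {i}"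
  let ?N = "Pi_pmf ?A False (\<lambda>_. bernoulli_pmf p)"
  have B: "bernoulli_trials n p = map_pmf (\<lambda>(x, f). f(i := x)) (pair_pmf (bernoulli_pmf p) ?N)"
    using Pi_pmf_insert[of ?A i False "\<lambda>_. bernoulli_pmf p"] assms(3)
    by (simp add: bernoulli_trials_def insert_absorb)
  have "(\<lambda>(x, f). f(i := x)) -` {w. w i = b \<and> P w} = {b} \<times> {w. P w}"
    and "(\<lambda>(x, f). f(i := x)) -` {w. P w} = UNIV \<times> {w. P w}"
    using assms(4) by auto
  then show ?thesis
    using assms(1,2)
    by (simp add: B prob_pair_pmf_Times measure_pmf_single)
qed

lemma prob_bernoulli_trials_success_block:
  assumes "0 \<le> p" "p \<le> 1" "s + k \<le> n"
    and "\<And>w w'. (\<forall>i>s+k. w i = w' i) \<Longrightarrow> P w = P w'"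
  shows "measure_pmf.prob (bernoulli_trials n p) {w. (\<forall>i\<in>{s+1..s+k}. w i) \<and> P w} =
    p ^ k * measure_pmf.prob (bernoulli_trials n p) {w. P w}"
  using assms(3,4)
proof (induction k arbitrary: P)
  case (Suc k)
  let ?M = "measure_pmf.prob (bernoulli_trials n p)"
  have "?M {w. (\<forall>i\<in>{s+1..s+Suc k}. w i) \<and> P w} =
      ?M {w. (\<forall>i\<in>{s+1..s+k}. w i) \<and> (w (s + Suc k) = True \<and> P w)}"
    by (intro arg_cong[where f = ?M]) (auto simp: atLeastAtMostSuc_conv)
  also have "\<dots> = p ^ k * ?M {w. w (s + Suc k) = True \<and> P w}"
  proof (rule Suc.IH)
    fix w w' :: "nat \<Rightarrow> bool" assume *: "\<forall>i>s+k. w i = w' i"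
    then have "P w = P w'" by (intro Suc.prems(2)) auto
    then show "(w (s + Suc k) = True \<and> P w) = (w' (s + Suc k) = True \<and> P w')"
      using * by simp
  qed (use Suc.prems in simp)
  also have "?M {w. w (s + Suc k) = True \<and> P w} = p * ?M {w. P w}"
    by (subst prob_bernoulli_trials_conj[OF assms(1,2)])
      (use Suc.prems in \<open>auto intro!: Suc.prems(2)\<close>)
  finally show ?case by simp
qed simp

section \<open>Recursion for the tail probabilities\<close>

lemma prob_runs_count_from_step:
  fixes k g n r :: nat and p :: real
  defines "R \<equiv> \<lambda>s r. measure_pmf.prob (bernoulli_trials n p) {w. r \<le> runs_count_from k g n w s}"
  assumes "k \<ge> 1" "g \<ge> 1" "0 \<le> p" "p \<le> 1" "r \<ge> 1" "s + k + 1 \<le> n"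
  shows "R s r = R (s + 1) r + p ^ k * (1 - p) * (R (s + k + g) (r - 1) - R (s + k + 1) r)"
proof -
  let ?M = "measure_pmf.prob (bernoulli_trials n p)"
  let ?N = "runs_count_from k g n"
  \<comment> \<open>Off \<open>E\<close> the counts from \<open>s\<close> and \<open>s + 1\<close>
    agree. Since \<open>s + k + 1 \<le> n\<close>, the closing failure is a genuine trial.\<close>
  define E where "E = {w. (\<forall>i\<in>{s+1..s+k}. w i) \<and> \<not> w (s + k + 1)}"
  have EM: "?M (E \<inter> {w. c \<le> ?N w t}) = p ^ k * (1 - p) * R t c" if "t \<ge> s + k + 1" for t c
  proof -
    have loc: "(c \<le> ?N w t) = (c \<le> ?N w' t)" if "\<forall>i>s+k+1. w i = w' i" for w w'
      using runs_count_from_local[of t w w'] that \<open>t \<ge> s + k + 1\<close> by simp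
    have "?M (E \<inter> {w. c \<le> ?N w t}) =
        ?M {w. (\<forall>i\<in>{s+1..s+k}. w i) \<and> (w (s + k + 1) = False \<and> c \<le> ?N w t)}"
      by (intro arg_cong[where f = ?M]) (auto simp: E_def)
    also have "\<dots> = p ^ k * ?M {w. w (s + k + 1) = False \<and> c \<le> ?N w t}"
    proof (rule prob_bernoulli_trials_success_block)
      fix w w' :: "nat \<Rightarrow> bool" assume *: "\<forall>i>s+k. w i = w' i"
      then show "(w (s + k + 1) = False \<and> c \<le> ?N w t) = (w' (s + k + 1) = False \<and> c \<le> ?N w' t)"
        using loc[of w w'] by simp
    qed (use assms in auto)
    also have "?M {w. w (s + k + 1) = False \<and> c \<le> ?N w t} = (1 - p) * ?M {w. c \<le> ?N w t}"
    proof (subst prob_bernoulli_trials_conj)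
      show "(c \<le> ?N (w(s + k + 1 := x)) t) = (c \<le> ?N w t)" for w x
        by (rule loc) auto
    qed (use assms in auto)
    finally show ?thesis by (simp add: R_def)
  qed
  have split: "?M X = ?M (E \<inter> X) + ?M (X - E)" for X
    by (subst measure_pmf.finite_measure_Union[symmetric]) (auto intro!: arg_cong[where f = ?M])
  have onE: "?N w s = Suc (?N w (s + k + g))" "?N w (s + 1) = ?N w (s + k + 1)" if "w \<in> E" for w
  proof -
    have "first_run_after k n w s (s + 1) (s + k)"
      using that assms by (intro first_run_after_Suc_start) (auto simp: E_def)
    then show "?N w s = Suc (?N w (s + k + g))" by (rule runs_count_from_Suc)
    show "?N w (s + 1) = ?N w (s + k + 1)"
      using that assms by (intro runs_count_from_skip) (auto simp: E_def)
  qed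
  have offE: "?N w s = ?N w (s + 1)" if "w \<notin> E" for w
  proof (cases "\<forall>i\<in>{s+1..s+k}. w i")
    case True
    then have "\<forall>i\<in>{s+1..s+k+1}. w i" using that by (auto simp: E_def le_Suc_eq)
    then show ?thesis using assms by (intro runs_count_from_Suc_start_long) auto
  next
    case False
    then show ?thesis using assms by (intro runs_count_from_Suc_start) auto
  qed
  \<comment> \<open>The part off \<open>E\<close> is expressed through the count from
    \<open>s + 1\<close>, so it cancels against the same term of \<open>R (s + 1) r\<close>.\<close>
  have "R s r = ?M (E \<inter> {w. r - 1 \<le> ?N w (s + k + g)}) + ?M ({w. r \<le> ?N w (s + 1)} - E)"
    unfolding R_def using onE(1) offE assms(6)
    by (subst split) (intro arg_cong2[where f = "(+)"] arg_cong[where f = ?M]; auto)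
  moreover have "R (s + 1) r =
      ?M (E \<inter> {w. r \<le> ?N w (s + k + 1)}) + ?M ({w. r \<le> ?N w (s + 1)} - E)"
    unfolding R_def using onE(2)
    by (subst split) (intro arg_cong2[where f = "(+)"] arg_cong[where f = ?M]; auto)
  ultimately show ?thesis
    using EM[of "s + k + g" "r - 1"] EM[of "s + k + 1" r] assms(3) by (simp add: algebra_simps)
qed

section \<open>The alternating sum and its recursion\<close>

text \<open>Adding 1 before the truncated subtractions turns a negative upper index into 0, where
  the binomial vanishes for \<open>m \<ge> 1\<close>.\<close>

definition tail_term :: "nat \<Rightarrow> nat \<Rightarrow> real \<Rightarrow> nat \<Rightarrow> nat \<Rightarrow> nat \<Rightarrow> real" where
  "tail_term k g p r n m =
     (-1) ^ (m - r) * (1 - p) ^ (m - 1) * p ^ (m * k) * real ((m - 1) choose (r - 1)) *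
     (real ((n + 1 - m * k - (r - 1) * (g - 1)) choose m)
      - p * real ((n - m * k - (r - 1) * (g - 1)) choose m))"

definition tail_sum :: "nat \<Rightarrow> nat \<Rightarrow> real \<Rightarrow> nat \<Rightarrow> nat \<Rightarrow> real" where
  "tail_sum k g p r n =
     (\<Sum>m = r..(n + 1 - (r - 1) * (g - 1)) div (k + 1). tail_term k g p r n m)"

text \<open>A common range allows sums for different \<open>n\<close> and \<open>r\<close> to be
  compared termwise. Below \<open>r\<close> the factor \<open>(m - 1) choose (r - 1)\<close>
  vanishes; above the upper limit both upper indices in the bracket are less than
  \<open>m\<close>.\<close>

lemma tail_sum_eq:
  assumes "k \<ge> 1" "r \<ge> 1" "n < M"
  shows "tail_sum k g p r n = (\<Sum>m = 1..M. tail_term k g p r n m)"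
  unfolding tail_sum_def
proof (rule sum.mono_neutral_left)
  let ?A = "(r - 1) * (g - 1)"
  have "(n + 1 - ?A) div (k + 1) \<le> n + 1"
    by (meson diff_le_self div_le_dividend le_trans)
  then show "{r..(n + 1 - ?A) div (k + 1)} \<subseteq> {1..M}" using assms by auto
  show "\<forall>m\<in>{1..M} - {r..(n + 1 - ?A) div (k + 1)}. tail_term k g p r n m = 0"
  proof
    fix m assume m: "m \<in> {1..M} - {r..(n + 1 - ?A) div (k + 1)}"
    show "tail_term k g p r n m = 0"
    proof (cases "m < r")
      case True
      then have "(m - 1) choose (r - 1) = 0" using m by (intro binomial_eq_0) auto
      then show ?thesis by (simp add: tail_term_def)
    next
      case False
      then have "(n + 1 - ?A) div (k + 1) < m" using m by auto
      then have "n + 1 - ?A < m * (k + 1)"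
        using div_less_iff_less_mult[of "k + 1" "n + 1 - ?A" m] by simp
      then have "n + 1 - m * k - ?A < m" "n - m * k - ?A < m"
        using m by (auto simp: algebra_simps)
      then show ?thesis by (simp add: tail_term_def binomial_eq_0)
    qed
  qed
qed simp

lemma tail_sum_eq_0:
  assumes "k \<ge> 1" "r \<ge> 1" "n < k"
  shows "tail_sum k g p r n = 0"
proof -
  have "(n + 1 - (r - 1) * (g - 1)) div (k + 1) = 0" using assms by simp
  then show ?thesis using assms by (simp add: tail_sum_def)
qed

text \<open>Base case: at most the term \<open>m = 1\<close> survives.\<close>

lemma tail_sum_k:
  assumes "k \<ge> 1" "r \<ge> 1"
  shows "tail_sum k g p r k = (if r = 1 then p ^ k else 0)"
proof -
  have "(k + 1 - (r - 1) * (g - 1)) div (k + 1) \<le> (k + 1) div (k + 1)"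
    by (intro div_le_mono) simp
  then have "(k + 1 - (r - 1) * (g - 1)) div (k + 1) \<le> 1" by simp
  then show ?thesis using assms by (auto simp: tail_sum_def tail_term_def)
qed

text \<open>Pascal's rule in the upper index reduces the bracket to a common factor
  \<open>T\<close>; Pascal's rule for \<open>m choose (r - 1)\<close> then splits the result into
  the terms for \<open>r - 1\<close> and \<open>r\<close>.\<close>

lemma tail_term_Suc_diff:
  assumes "k \<ge> 1" "g \<ge> 1" "r \<ge> 1" "m \<ge> 1" "n \<ge> k"
  shows "tail_term k g p r (Suc n) (Suc m) - tail_term k g p r n (Suc m) =
    (1 - p) * p ^ k * ((if r = 1 then 0 else tail_term k g p (r - 1) (n + 1 - k - g) m)
      - tail_term k g p r (n - k) m)"
proof -
  let ?A = "(r - 1) * (g - 1)"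
  \<comment> \<open>If \<open>d > x\<close>, truncation makes all upper indices 0, and all three
    binomials vanish because \<open>m \<ge> 1\<close>.\<close>
  have pascal: "real (Suc x - d choose Suc m) - real (x - d choose Suc m) = real (x - d choose m)"
    for x d
  proof (cases "d \<le> x")
    case True
    then show ?thesis by (simp add: Suc_diff_le)
  next
    case False
    then show ?thesis using assms by (simp add: binomial_eq_0)
  qed
  define B where "B x = real (x - (Suc m * k + ?A) choose m)" for x
  define T where "T = B (n + 1) - p * B n"
  have "real (Suc n + 1 - Suc m * k - ?A choose Suc m) - p * real (Suc n - Suc m * k - ?A choose Suc m)
      - (real (n + 1 - Suc m * k - ?A choose Suc m) - p * real (n - Suc m * k - ?A choose Suc m)) = T"
    using pascal[of "n + 1" "Suc m * k + ?A"] pascal[of n "Suc m * k + ?A"]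
    unfolding T_def B_def by (simp add: algebra_simps)
  then have L: "tail_term k g p r (Suc n) (Suc m) - tail_term k g p r n (Suc m) =
      (-1) ^ (Suc m - r) * (1 - p) ^ m * p ^ (Suc m * k) * real (m choose (r - 1)) * T"
    unfolding tail_term_def right_diff_distrib[symmetric] by simp
  have "n - k + 1 - m * k - ?A = n + 1 - (Suc m * k + ?A)" "n - k - m * k - ?A = n - (Suc m * k + ?A)"
    using assms by simp_all
  then have R: "tail_term k g p r (n - k) m =
      (-1) ^ (m - r) * (1 - p) ^ (m - 1) * p ^ (m * k) * real ((m - 1) choose (r - 1)) * T"
    by (simp add: tail_term_def T_def B_def)
  have pw: "(1 - p) ^ m = (1 - p) * (1 - p) ^ (m - 1)"
    using assms(4) by (metis power_eq_if not_one_le_zero)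
  show ?thesis
  proof (cases "r = 1")
    case True
    have "(-1) ^ m = - ((-1::real) ^ (m - 1))"
      using assms(4) by (cases m) auto
    then show ?thesis
      unfolding L R pw using True by (simp add: power_add)
  next
    case False
    then obtain c where r: "r = Suc (Suc c)"
      using assms(3) by (metis One_nat_def not0_implies_Suc not_one_le_zero)
    obtain l where m: "m = Suc l" using assms(4) by (cases m) auto
    \<comment> \<open>\<open>n + 1 - k - g\<close> may be truncated to 0; the 1 added afterwards is
      then absorbed by \<open>u \<ge> 1\<close>.\<close>
    have trunc: "n + 1 - k - g + 1 - u - v = n + 1 - (k + u + (g - 1 + v))"
      "n + 1 - k - g - u - v = n - (k + u + (g - 1 + v))" if "u \<ge> 1" for u v
      using that assms(2,5) by arith+
    have "n + 1 - k - g + 1 - m * k - c * (g - 1) = n + 1 - (Suc m * k + ?A)"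
      "n + 1 - k - g - m * k - c * (g - 1) = n - (Suc m * k + ?A)"
      using trunc[of "m * k" "c * (g - 1)"] assms(1,4) r by simp_all
    then have R': "tail_term k g p (r - 1) (n + 1 - k - g) m =
        (-1) ^ (Suc m - r) * (1 - p) ^ (m - 1) * p ^ (m * k) * real ((m - 1) choose (r - 2)) * T"
      by (simp add: tail_term_def T_def B_def r)
    \<comment> \<open>For \<open>r > m\<close> the truncated exponents do not flip the sign, but the
      binomial is 0.\<close>
    have sign: "(-1) ^ (m - r) * real ((m - 1) choose (r - 1)) =
        - ((-1) ^ (Suc m - r) * real ((m - 1) choose (r - 1)))"
    proof (cases "r \<le> m")
      case True
      then show ?thesis by (simp add: Suc_diff_le)
    next
      case False
      then show ?thesis using m by (simp add: binomial_eq_0)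
    qed
    have "tail_term k g p r (n - k) m =
        ((-1) ^ (m - r) * real ((m - 1) choose (r - 1))) * ((1 - p) ^ (m - 1) * p ^ (m * k) * T)"
      unfolding R by (simp only: mult_ac)
    then have R2: "tail_term k g p r (n - k) m =
        - ((-1) ^ (Suc m - r) * (1 - p) ^ (m - 1) * p ^ (m * k) * real ((m - 1) choose (r - 1)) * T)"
      unfolding sign by (simp add: mult_ac)
    have "real (m choose (r - 1)) = real ((m - 1) choose (r - 2)) + real ((m - 1) choose (r - 1))"
      by (simp add: r m)
    then show ?thesis
      unfolding L R' R2 pw using False by (simp add: power_add algebra_simps)
  qed
qed

lemma tail_sum_step:
  assumes "k \<ge> 1" "g \<ge> 1" "r \<ge> 1" "n \<ge> k"
  shows "tail_sum k g p r (Suc n) = tail_sum k g p r n + p ^ k * (1 - p) *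
    ((if r = 1 then 1 else tail_sum k g p (r - 1) (n + 1 - k - g)) - tail_sum k g p r (n - k))"
proof -
  let ?t = "tail_term k g p"
  have split: "(\<Sum>m = 1..Suc N. f m) = f 1 + (\<Sum>m = 1..N. f (Suc m))"
    for f :: "nat \<Rightarrow> real" and N
    by (induction N) simp_all
  \<comment> \<open>The term \<open>m = 1\<close> has no predecessor after the index shift; for
    \<open>r = 1\<close> it supplies the 1 that stands for the probability of at least 0
    runs.\<close>
  have one: "?t r (Suc n) 1 - ?t r n 1 = (if r = 1 then p ^ k * (1 - p) else 0)"
  proof (cases "r = 1")
    case True
    then show ?thesis using assms by (simp add: tail_term_def algebra_simps Suc_diff_le)
  next
    case False
    then show ?thesis using assms by (simp add: tail_term_def binomial_eq_0)
  qed
  \<comment> \<open>The range is large enough for all four sums, also after the shift to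
    \<open>n + 2\<close>.\<close>
  have "tail_sum k g p r (Suc n) - tail_sum k g p r n =
      (\<Sum>m = 1..Suc (n+2). ?t r (Suc n) m - ?t r n m)"
    using assms tail_sum_eq[of k r "Suc n" "Suc (n+2)" g p] tail_sum_eq[of k r n "Suc (n+2)" g p]
    by (simp only: sum_subtractf)
  also have "\<dots> = (?t r (Suc n) 1 - ?t r n 1) + (\<Sum>m = 1..n+2. ?t r (Suc n) (Suc m) - ?t r n (Suc m))"
    by (rule split)
  also have "(\<Sum>m = 1..n+2. ?t r (Suc n) (Suc m) - ?t r n (Suc m)) =
      (1 - p) * p ^ k * ((\<Sum>m = 1..n+2. if r = 1 then 0 else ?t (r - 1) (n + 1 - k - g) m)
        - (\<Sum>m = 1..n+2. ?t r (n - k) m))"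
    unfolding sum_subtractf[symmetric] sum_distrib_left
    using assms by (intro sum.cong refl tail_term_Suc_diff) auto
  also have "(\<Sum>m = 1..n+2. ?t r (n - k) m) = tail_sum k g p r (n - k)"
    using assms by (intro tail_sum_eq[symmetric]) auto
  also have "(\<Sum>m = 1..n+2. if r = 1 then 0 else ?t (r - 1) (n + 1 - k - g) m) =
      (if r = 1 then 0 else tail_sum k g p (r - 1) (n + 1 - k - g))"
    using assms tail_sum_eq[of k "r - 1" "n + 1 - k - g" "n + 2" g p] by auto
  finally show ?thesis unfolding one using assms by (auto simp: algebra_simps)
qed

section \<open>Tail probabilities as alternating sums\<close>

text \<open>Strong induction on the number \<open>n - s\<close> of remaining trials: fewer than
  \<open>k\<close> and exactly \<open>k\<close> are base cases, and beyond that both sides obey the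
  same recursion.\<close>

lemma prob_runs_count_from_eq_tail_sum:
  assumes "k \<ge> 1" "g \<ge> 1" "0 \<le> p" "p \<le> 1" "r \<ge> 1" "s \<le> n"
  shows "measure_pmf.prob (bernoulli_trials n p) {w. r \<le> runs_count_from k g n w s}
    = tail_sum k g p r (n - s)"
  using assms(5,6)
proof (induction "n - s" arbitrary: r s rule: less_induct)
  case less
  define R where "R s r = measure_pmf.prob (bernoulli_trials n p) {w. r \<le> runs_count_from k g n w s}"
    for s r
  have R0: "R t c = 0" if "n < t + k" "c \<ge> 1" for t c
    using that by (simp add: R_def runs_count_from_eq_0)
  \<comment> \<open>The restart \<open>s + k + g\<close> may lie beyond \<open>n\<close>; then
    \<open>n - t\<close> is 0 and both sides vanish.\<close>
  have IH: "R t c = tail_sum k g p c (n - t)" if "s < t" "c \<ge> 1" for t c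
  proof (cases "t \<le> n")
    case True
    then show ?thesis using less.hyps[of t c] that by (simp add: R_def)
  next
    case False
    then show ?thesis using that assms(1) R0[of t c] by (simp add: tail_sum_eq_0)
  qed
  consider "n < s + k" | "n = s + k" | "s + k + 1 \<le> n" by linarith
  then have "R s r = tail_sum k g p r (n - s)"
  proof cases
    case 1
    then show ?thesis using assms(1) less.prems R0[of s r] by (simp add: tail_sum_eq_0)
  next
    case 2
    \<comment> \<open>Here the end of the trials takes the place of the closing failure.\<close>
    have N: "runs_count_from k g n w s = (if \<forall>i\<in>{s+1..s+k}. w i then 1 else 0)" for w
    proof (cases "\<forall>i\<in>{s+1..s+k}. w i")
      case True
      then have "first_run_after k n w s (s + 1) n"
        using 2 assms(1) by (intro first_run_after_Suc_start) auto
      from runs_count_from_Suc[OF this, of g] show ?thesis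
        using True assms by (simp add: runs_count_from_eq_0)
    next
      case False
      then show ?thesis
        using 2 assms(1) runs_count_from_Suc_start[OF assms(1) False, of g n]
        by (auto simp: runs_count_from_eq_0)
    qed
    have "R s r = (if r = 1 then p ^ k else 0)"
    proof (cases "r = 1")
      case True
      then have "R s r = measure_pmf.prob (bernoulli_trials n p) {w. (\<forall>i\<in>{s+1..s+k}. w i) \<and> True}"
        unfolding R_def by (intro arg_cong[where f = "measure_pmf.prob _"]) (auto simp: N)
      also have "\<dots> = p ^ k * measure_pmf.prob (bernoulli_trials n p) {w. True}"
        using 2 assms by (intro prob_bernoulli_trials_success_block) auto
      finally show ?thesis using True by simp
    next
      case False
      then have "{w. r \<le> runs_count_from k g n w s} = {}" using less.prems by (auto simp: N)
      then show ?thesis using False by (simp add: R_def)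
    qed
    then show ?thesis using 2 assms(1) less.prems by (simp add: tail_sum_k)
  next
    case 3
    \<comment> \<open>Chosen so that \<open>Suc ?n\<close> trials remain after \<open>s\<close> and
      \<open>?n - k\<close> after \<open>s + k + 1\<close>.\<close>
    let ?n = "n - s - 1"
    have step: "R s r = R (s + 1) r + p ^ k * (1 - p) * (R (s + k + g) (r - 1) - R (s + k + 1) r)"
      unfolding R_def using prob_runs_count_from_step[OF assms(1-4) less.prems(1) 3] .
    have a: "R (s + 1) r = tail_sum k g p r ?n" "R (s + k + 1) r = tail_sum k g p r (?n - k)"
      using IH[of "s + 1" r] IH[of "s + k + 1" r] less.prems by (simp_all add: algebra_simps)
    have b: "R (s + k + g) (r - 1) =
        (if r = 1 then 1 else tail_sum k g p (r - 1) (?n + 1 - k - g))"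
    proof (cases "r = 1")
      case True then show ?thesis by (simp add: R_def)
    next
      case False
      have "n - (s + k + g) = ?n + 1 - k - g" using 3 by simp
      then show ?thesis using False less.prems assms IH[of "s + k + g" "r - 1"] by simp
    qed
    have "Suc ?n = n - s" using 3 by simp
    then show ?thesis
      using tail_sum_step[of k g r ?n p] assms less.prems 3 unfolding step a b by simp
  qed
  then show ?case by (simp add: R_def)
qed

theorem mainTheorem1:
  fixes k g n r :: nat and p q :: real
  assumes "k \<ge> 1" and "g \<ge> 1" and "n \<ge> 1" and "r \<ge> 1"
    and "0 < p" and "p < 1" and "q = 1 - p"
  shows "success_runs_prob k g p n r =
    (\<Sum>m = r..(n + 1 - (r - 1) * (g - 1)) div (k + 1).
       (-1) ^ (m - r) * q ^ (m - 1) * p ^ (m * k) * real ((m - 1) choose (r - 1)) *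
       (real ((n + 1 - m * k - (r - 1) * (g - 1)) choose m)
        - p * real ((n - m * k - (r - 1) * (g - 1)) choose m)))
    - (\<Sum>m = r + 1..(n + 1 - r * (g - 1)) div (k + 1).
       (-1) ^ (m - r - 1) * q ^ (m - 1) * p ^ (m * k) * real ((m - 1) choose r) *
       (real ((n + 1 - m * k - r * (g - 1)) choose m)
        - p * real ((n - m * k - r * (g - 1)) choose m)))"
proof -
  let ?M = "measure_pmf.prob (bernoulli_trials n p)"
  let ?N = "\<lambda>w. runs_count_from k g n w 0"
  \<comment> \<open>Exactly \<open>r\<close> runs is a difference of two nested tail events.\<close>
  have "success_runs_prob k g p n r = ?M ({w. r \<le> ?N w} - {w. r + 1 \<le> ?N w})"
    unfolding success_runs_prob_def num_success_runs_eq
    by (intro arg_cong[where f = ?M]) auto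
  also have "\<dots> = ?M {w. r \<le> ?N w} - ?M {w. r + 1 \<le> ?N w}"
    by (rule measure_pmf.finite_measure_Diff) auto
  also have "\<dots> = tail_sum k g p r n - tail_sum k g p (r + 1) n"
    using prob_runs_count_from_eq_tail_sum[of k g p _ 0 n] assms by simp
  finally show ?thesis
    by (simp add: tail_sum_def tail_term_def assms(7))
qed

end
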